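(* Let $w_1\ge w_2\ge\dots\ge w_n>0$ with $\sum_i w_i=1$, and consider the FMMR algorithm applied to the move-to-front (MTF) chain on the symmetric group $\mathcal S_n$ with weight vector $(w_1,\dots,w_n)$ and the MTF transition rule. Let $T_{\mathrm{FMMR}}$ be its running time and $Z_{\mathrm{FMMR}}$ its initial state. For $z\in\mathcal S_n$ put $y_r:=w_{z_r}$ for $1\le r\le n$ and $y_r^+:=\sum_{j=1}^r y_j$ for $0\le r\le n$; similarly $w_r^+:=\sum_{j=1}^r w_j$. (a) The conditional distribution of $T_{\mathrm{FMMR}}$ given $Z_{\mathrm{FMMR}}=z$ equals the law $\mathcal L(T_z)$ of a random variable $$T_z\sim\bigoplus_{r=0}^{n-2}\mathrm{Geom}(1-y_r^+),$$ i.e. the convolution of the $\mathrm{Geometric}(1-y_r^+)$ distributions, $0\le r\le n-2$. (b) The random variables $T_z$ decrease stochastically in the Bruhat order for $z$: if $z\le z'$ in the Bruhat order, then $P(T_{z'}>t)\le P(T_z>t)$ for all $t$. (c) The distribution $\mathcal L(T_z)$ is stochastically minimized over $z\in\mathcal S_n$ by choosing $z=\mathrm{rev}=(n,n-1,\dots,1)$ and stochastically maximized by choosing $z=\mathrm{id}=(1,2,\dots,n)$. In these cases $$T_{\mathrm{rev}}\sim\bigoplus_{r=2}^{n}\mathrm{Geom}(w_r^+),\qquad T_{\mathrm{id}}\sim\bigoplus_{r=0}^{n-2}\mathrm{Geom}(1-w_r^+).$$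
   Context: $\mathrm{Geom}(p)$ is the geometric distribution on $\{1,2,\dots\}$ with success probability $p$ (so $\mathrm{Geom}(1)$ is the point mass at $1$), and $\bigoplus$ denotes convolution (the law of a sum of independent random variables). $X$ is stochastically smaller than $Y$ if $P(X>t)\le P(Y>t)$ for all $t$. MTF chain: states are permutations $z=(z_1,\dots,z_n)\in\mathcal S_n$ of $\{1,\dots,n\}$, viewed as lists. At each step record $i$ is requested with probability $w_i$, independently of the past, and moved to the front of the list, leaving the relative order of the other records unchanged. The MTF transition rule is $\phi(z,i)=\mathrm{move}_i(z)$, the list obtained from $z$ by moving $i$ to the front, with driving variable $U$, $P(U=i)=w_i$. The chain is ergodic with stationary distribution $\pi(z)=\prod_{r=1}^n \frac{w_{z_r}}{\sum_{j=r}^n w_{z_j}}$. Let $K$ be its transition matrix and $\tilde K$ its time-reversal, defined by $\pi(x)K(x,y)=\pi(y)\tilde K(y,x)$. FMMR: start at $\mathbf X_0=Z_{\mathrm{FMMR}}$ and run $\tilde K$ to obtain $\mathbf X_0,\mathbf X_{-1},\mathbf X_{-2},\dots$. Conditionally given the $\mathbf X$-values, generate $U_0,U_{-1},\dots$ independently, with $U_s$ drawn from the conditional distribution of $U$ given $\phi(\mathbf X_{s-1},U)=\mathbf X_s$. For $t=0,1,\dots$ and each state $x$ set $\mathbf Y^{(-t)}_{-t}(x)=x$ and $\mathbf Y^{(-t)}_s(x)=\phi(\mathbf Y^{(-t)}_{s-1}(x),U_s)$ for $-t+1\le s\le0$. The running time $T_{\mathrm{FMMR}}$ is the smallest $t$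 such that the values $\mathbf Y_0^{(-t)}(x)$ agree for all $x\in\mathcal S_n$. Conditioning on $Z_{\mathrm{FMMR}}=z$ means running FMMR from initial state $\mathbf X_0=z$. Bruhat order on $\mathcal S_n$: $z\le z'$ if $z'$ can be obtained from $z$ by a sequence of transpositions of two (not necessarily adjacent) entries of the list, each of which switches out of order two records that are in natural order before the switch (i.e. the smaller record precedes the larger one before the switch). *)

theory Defs
  imports "HOL-Probability.Probability" "HOL-Combinatorics.Multiset_Permutations"
begin

text \<open>Throughout, \<open>\<mu>\<close> is the law of the driving variable and
  \<open>\<phi> x u\<close> the transition rule. Time runs backwards from 0: \<open>X k\<close> and \<open>U k\<close>
  stand for the variables $X_{-k}$ and $U_{-k}$.\<close>

definition transition_matrix :: "'u pmf \<Rightarrow> ('s \<Rightarrow> 'u \<Rightarrow> 's) \<Rightarrow> 's \<Rightarrow> 's \<Rightarrow> real" where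
  "transition_matrix \<mu> \<phi> x y = measure_pmf.prob \<mu> {u. \<phi> x u = y}"

definition time_reversal :: "('s \<Rightarrow> real) \<Rightarrow> ('s \<Rightarrow> 's \<Rightarrow> real) \<Rightarrow> 's \<Rightarrow> 's \<Rightarrow> real" where
  "time_reversal \<pi> K y x = \<pi> x * K x y / \<pi> y"

text \<open>A realisation, on a probability space \<open>M\<close>, of the random input of FMMR started at \<open>z\<close>.
  The last two conditions prescribe the finite-dimensional laws: \<open>X\<close> is the reversed chain
  from \<open>z\<close>, and given \<open>X\<close> the \<open>U k\<close> are independent, \<open>U k\<close> having the law \<open>\<mu>\<close> conditioned on
  \<open>\<phi> (X (k + 1)) (U k) = X k\<close>. The conditioning event is null only for
  paths \<open>x\<close> that have probability 0, where the value of \<^const>\<open>cond_pmf\<close> is irrelevant.\<close>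

definition fmmr_run ::
  "'u pmf \<Rightarrow> ('s \<Rightarrow> 'u \<Rightarrow> 's) \<Rightarrow> ('s \<Rightarrow> real) \<Rightarrow> 's \<Rightarrow>
   'a measure \<Rightarrow> (nat \<Rightarrow> 'a \<Rightarrow> 's) \<Rightarrow> (nat \<Rightarrow> 'a \<Rightarrow> 'u) \<Rightarrow> bool" where
  "fmmr_run \<mu> \<phi> \<pi> z M X U \<longleftrightarrow>
     prob_space M \<and>
     (\<forall>k. X k \<in> measurable M (count_space UNIV)) \<and>
     (\<forall>k. U k \<in> measurable M (count_space UNIV)) \<and>
     (\<forall>t x. measure M {\<omega> \<in> space M. \<forall>k\<le>t. X k \<omega> = x k} =
        (if x 0 = z then \<Prod>k<t. time_reversal \<pi> (transition_matrix \<mu> \<phi>) (x k) (x (Suc k)) else 0)) \<and>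
     (\<forall>t x u. measure M {\<omega> \<in> space M. (\<forall>k\<le>t. X k \<omega> = x k) \<and> (\<forall>k<t. U k \<omega> = u k)} =
        measure M {\<omega> \<in> space M. \<forall>k\<le>t. X k \<omega> = x k} *
        (\<Prod>k<t. pmf (cond_pmf \<mu> {v. \<phi> (x (Suc k)) v = x k}) (u k)))"

text \<open>\<open>fmmr_Y \<phi> u t j x\<close> is $Y^{(-t)}_{-t+j}(x)$ for \<open>j \<le> t\<close>; the step to time $-t+j+1$ uses
  $U_{-t+j+1}$, whose index here is \<open>t - Suc j\<close>.\<close>

primrec fmmr_Y :: "('s \<Rightarrow> 'u \<Rightarrow> 's) \<Rightarrow> (nat \<Rightarrow> 'u) \<Rightarrow> nat \<Rightarrow> nat \<Rightarrow> 's \<Rightarrow> 's" where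
  "fmmr_Y \<phi> u t 0 x = x"
| "fmmr_Y \<phi> u t (Suc j) x = \<phi> (fmmr_Y \<phi> u t j x) (u (t - Suc j))"

text \<open>The value is \<open>\<infinity>\<close> if coalescence never occurs.\<close>

definition fmmr_time :: "'s set \<Rightarrow> ('s \<Rightarrow> 'u \<Rightarrow> 's) \<Rightarrow> (nat \<Rightarrow> 'u) \<Rightarrow> enat" where
  "fmmr_time S \<phi> u =
     Inf {enat t | t. \<forall>x\<in>S. \<forall>x'\<in>S. fmmr_Y \<phi> u t t x = fmmr_Y \<phi> u t t x'}"

abbreviation perms :: "nat \<Rightarrow> nat list set" where
  "perms n \<equiv> permutations_of_set {1..n}"

definition move_to_front :: "nat list \<Rightarrow> nat \<Rightarrow> nat list" where
  "move_to_front z i = i # remove1 i z"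

definition request_pmf :: "nat \<Rightarrow> (nat \<Rightarrow> real) \<Rightarrow> nat pmf" where
  "request_pmf n w = embed_pmf (\<lambda>i. if i \<in> {1..n} then w i else 0)"

text \<open>The weight $y_r = w_{z_r}$; list positions are counted from 1 here.\<close>

definition yw :: "(nat \<Rightarrow> real) \<Rightarrow> nat list \<Rightarrow> nat \<Rightarrow> real" where
  "yw w z r = w (z ! (r - 1))"

definition yw_plus :: "(nat \<Rightarrow> real) \<Rightarrow> nat list \<Rightarrow> nat \<Rightarrow> real" where
  "yw_plus w z r = (\<Sum>j=1..r. yw w z j)"

definition w_plus :: "(nat \<Rightarrow> real) \<Rightarrow> nat \<Rightarrow> real" where
  "w_plus w r = (\<Sum>j=1..r. w j)"

definition mtf_stationary :: "nat \<Rightarrow> (nat \<Rightarrow> real) \<Rightarrow> nat list \<Rightarrow> real" where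
  "mtf_stationary n w z =
     (if z \<in> perms n then \<Prod>r=1..n. yw w z r / (\<Sum>j=r..n. yw w z j) else 0)"

text \<open>The geometric law on $\{1,2,\dots\}$; \<^const>\<open>geometric_pmf\<close> counts from 0.\<close>

definition Geom :: "real \<Rightarrow> nat pmf" where
  "Geom p = map_pmf Suc (geometric_pmf p)"

definition Geom_conv :: "'i set \<Rightarrow> ('i \<Rightarrow> real) \<Rightarrow> nat pmf" where
  "Geom_conv I p = map_pmf (\<lambda>g. \<Sum>r\<in>I. g r) (Pi_pmf I 0 (\<lambda>r. Geom (p r)))"

text \<open>The range \<open>r < n - 1\<close> is $0 \le r \le n-2$, also for \<open>n = 1\<close>, when it is empty.\<close>

definition law_T :: "nat \<Rightarrow> (nat \<Rightarrow> real) \<Rightarrow> nat list \<Rightarrow> nat pmf" where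
  "law_T n w z = Geom_conv {..<n - 1} (\<lambda>r. 1 - yw_plus w z r)"

definition stoch_le :: "nat pmf \<Rightarrow> nat pmf \<Rightarrow> bool" where
  "stoch_le p q \<longleftrightarrow>
     (\<forall>t::real. measure_pmf.prob p {k. real k > t} \<le> measure_pmf.prob q {k. real k > t})"

definition bruhat_step :: "nat list \<Rightarrow> nat list \<Rightarrow> bool" where
  "bruhat_step z z' \<longleftrightarrow>
     (\<exists>i j. i < j \<and> j < length z \<and> z ! i < z ! j \<and> z' = z[i := z ! j, j := z ! i])"

definition bruhat_le :: "nat list \<Rightarrow> nat list \<Rightarrow> bool" where
  "bruhat_le = bruhat_step\<^sup>*\<^sup>*"

end

theory Submission
  imports Defs
begin

text \<open>Given \<open>X 0 = z\<close>, the probability that \<open>X t = s\<close> and that the requests \<open>U 0, \<dots>, U (t - 1)\<close> are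
  \<open>us\<close> is $\pi(s) \prod_k w_{us_k} / \pi(z)$ if applying \<open>us\<close> to \<open>s\<close> yields \<open>z\<close>, and 0 otherwise.
  In the first case the distinct records of \<open>us\<close>, in the order of first occurrence, form an initial
  segment of \<open>z\<close>. Summing over \<open>s\<close> shows that, given \<open>us\<close>, an already requested record \<open>i\<close> comes
  next with probability \<open>w i\<close>. So after \<open>r\<close> distinct records a new one appears with probability
  $1 - y_r^+$, and coalescence happens as soon as \<open>n - 1\<close> distinct records have appeared.
  The distribution functions of these numbers of distinct records and of the partial convolutions of
  geometric laws satisfy the same recurrence, which also yields monotonicity in the success
  probabilities. Since the weights decrease, every $y_r^+$ decreases along the Bruhat order and lies
  between its values at \<open>rev\<close> and \<open>id\<close>.\<close>

section \<open>Convolutions of geometric laws\<close>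

lemma Geom_conv_empty: "Geom_conv {} p = return_pmf 0"
  by (simp add: Geom_conv_def)

lemma Geom_conv_insert:
  assumes "finite A" "x \<notin> A"
  shows "Geom_conv (insert x A) p =
    map_pmf (\<lambda>(a, b). a + b) (pair_pmf (Geom (p x)) (Geom_conv A p))"
proof -
  have *: "(\<Sum>r\<in>A. if r = x then a else b r) = sum b A" for a :: nat and b
    using assms by (intro sum.cong) auto
  show ?thesis
    using assms unfolding Geom_conv_def
    by (simp add: Pi_pmf_insert pair_map_pmf2 pmf.map_comp o_def case_prod_unfold apsnd_def map_prod_def
        fun_upd_def * cong: if_cong)
qed

lemma Geom_conv_cong:
  assumes "\<And>r. r \<in> A \<Longrightarrow> p r = q r"
  shows "Geom_conv A p = Geom_conv A q"
  using assms unfolding Geom_conv_def by (auto intro!: arg_cong[where f="map_pmf _"] Pi_pmf_cong)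

lemma Geom_conv_reindex:
  assumes "finite A" "inj_on h A"
  shows "Geom_conv (h ` A) p = Geom_conv A (\<lambda>r. p (h r))"
  using assms by (induction A) (simp_all add: Geom_conv_empty Geom_conv_insert)

text \<open>Conditioning on the first trial: a success gives the value 1, a failure costs one trial
  and starts afresh.\<close>

lemma Geom_unfold:
  assumes "0 < p" "p \<le> 1"
  shows "Geom p = bernoulli_pmf p \<bind> (\<lambda>b. if b then return_pmf 1 else map_pmf Suc (Geom p))"
proof -
  have "Geom p = map_pmf Suc (bernoulli_pmf p \<bind>
      (\<lambda>b. if b then return_pmf 0 else map_pmf Suc (geometric_pmf p)))"
    using assms unfolding Geom_def by (subst geometric_bind_pmf_unfold) auto
  also have "\<dots> = bernoulli_pmf p \<bind> (\<lambda>b. if b then return_pmf 1 else map_pmf Suc (Geom p))"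
    unfolding map_bind_pmf Geom_def by (intro bind_pmf_cong) auto
  finally show ?thesis .
qed

text \<open>Total probability for a coin toss, derived in \<open>ennreal\<close>, where the measure
  of a bound law is an integral.\<close>

lemma prob_bind_bernoulli:
  assumes "0 \<le> p" "p \<le> 1"
  shows "measure_pmf.prob (bernoulli_pmf p \<bind> N) X =
    p * measure_pmf.prob (N True) X + (1 - p) * measure_pmf.prob (N False) X"
proof -
  have "ennreal (measure_pmf.prob (bernoulli_pmf p \<bind> N) X) =
      ennreal (p * measure_pmf.prob (N True) X + (1 - p) * measure_pmf.prob (N False) X)"
    using assms
    by (simp add: measure_pmf.emeasure_eq_measure[symmetric] ennreal_plus ennreal_mult mult.commute)
  then show ?thesis
    using assms by (subst (asm) ennreal_inj) auto
qed

text \<open>Condition on the first trial of stage \<open>m\<close>: after a failure the memoryless stage restarts.\<close>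

lemma Geom_conv_cdf_Suc:
  assumes "0 < p m" "p m \<le> 1"
  shows "measure_pmf.prob (Geom_conv {..<Suc m} p) {..Suc t} =
    p m * measure_pmf.prob (Geom_conv {..<m} p) {..t} +
    (1 - p m) * measure_pmf.prob (Geom_conv {..<Suc m} p) {..t}"
proof -
  let ?C = "Geom_conv {..<m} p"
  define N where "N b = map_pmf (\<lambda>(a, b). a + b)
     (pair_pmf (if b then return_pmf 1 else map_pmf Suc (Geom (p m))) ?C)" for b
  have C: "Geom_conv {..<Suc m} p = map_pmf (\<lambda>(a, b). a + b) (pair_pmf (Geom (p m)) ?C)"
    by (simp add: lessThan_Suc Geom_conv_insert)
  have "Geom_conv {..<Suc m} p = bernoulli_pmf (p m) \<bind> N"
    unfolding C N_def
    by (subst Geom_unfold[OF assms])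
      (simp add: pair_pmf_def map_bind_pmf bind_assoc_pmf)
  moreover have "N True = map_pmf Suc ?C"
    by (simp add: N_def pair_return_pmf1 pmf.map_comp o_def)
  moreover have "N False = map_pmf Suc (Geom_conv {..<Suc m} p)"
    by (simp add: C N_def pair_map_pmf1 pmf.map_comp o_def case_prod_unfold)
  moreover have "Suc -` {..Suc t} = {..t}"
    by auto
  ultimately show ?thesis
    using assms prob_bind_bernoulli[of "p m" N "{..Suc t}"] by simp
qed

text \<open>Every stage takes at least one trial, and there is at least one stage. Together with the
  empty sum this gives the boundary values of the recurrence.\<close>

lemma Geom_conv_cdf_0:
  "measure_pmf.prob (Geom_conv {..<Suc m} p) {..0} = 0"
proof -
  have "set_pmf (Geom_conv {..<Suc m} p) \<inter> {..0} = {}"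
    by (auto simp: lessThan_Suc Geom_conv_insert Geom_def)
  then show ?thesis
    by (subst measure_pmf_zero_iff)
qed

text \<open>Stage \<open>m\<close> adds a nonnegative amount, so dropping it can only shorten the
  total time.\<close>

lemma Geom_conv_cdf_decreasing:
  "measure_pmf.prob (Geom_conv {..<Suc m} p) {..t} \<le> measure_pmf.prob (Geom_conv {..<m} p) {..t}"
proof -
  have "(\<lambda>(a, b). a + b) -` {..t} \<subseteq> snd -` {..t}"
    by auto
  then have "measure_pmf.prob (Geom_conv {..<Suc m} p) {..t}
      \<le> measure_pmf.prob (map_pmf snd (pair_pmf (Geom (p m)) (Geom_conv {..<m} p))) {..t}"
    by (simp add: lessThan_Suc Geom_conv_insert measure_pmf.finite_measure_mono)
  then show ?thesis
    by (simp add: map_snd_pair_pmf)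
qed

text \<open>The recurrence writes the value at \<open>Suc t\<close> as a convex combination of the
  values at \<open>t\<close> for \<open>k\<close> and for \<open>Suc k\<close> stages. By induction
  both values grow when \<open>p\<close> is replaced by \<open>q\<close>, and the larger weight
  \<open>q k\<close> helps because fewer stages give the larger value.\<close>

lemma Geom_conv_cdf_mono:
  fixes p q :: "nat \<Rightarrow> real"
  assumes "\<And>r. r < m \<Longrightarrow> 0 < p r" "\<And>r. r < m \<Longrightarrow> p r \<le> q r" "\<And>r. r < m \<Longrightarrow> q r \<le> 1"
  shows "measure_pmf.prob (Geom_conv {..<m} p) {..t} \<le> measure_pmf.prob (Geom_conv {..<m} q) {..t}"
  using assms
proof (induction t arbitrary: m)
  case 0
  show ?case
  proof (cases m)
    case 0
    then show ?thesis by (simp add: Geom_conv_empty)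
  next
    case (Suc k)
    then show ?thesis by (simp only: Geom_conv_cdf_0)
  qed
next
  case (Suc t)
  show ?case
  proof (cases m)
    case 0
    then show ?thesis by (simp add: Geom_conv_empty)
  next
    case m: (Suc k)
    let ?P = "\<lambda>m. measure_pmf.prob (Geom_conv {..<m} p) {..t}"
    let ?Q = "\<lambda>m. measure_pmf.prob (Geom_conv {..<m} q) {..t}"
    have pq: "0 < p k" "p k \<le> q k" "q k \<le> 1"
      using Suc.prems m by auto
    then have "0 \<le> p k" "p k \<le> 1"
      by auto
    then have "p k * ?P k + (1 - p k) * ?P (Suc k) \<le> p k * ?Q k + (1 - p k) * ?Q (Suc k)"
      using Suc.prems m by (intro add_mono mult_left_mono Suc.IH) auto
    \<comment> \<open>Weight is shifted from \<open>?Q (Suc k)\<close> to the larger value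
      \<open>?Q k\<close>.\<close>
    also have "\<dots> \<le> q k * ?Q k + (1 - q k) * ?Q (Suc k)"
      using mult_right_mono[of "p k" "q k" "?Q k - ?Q (Suc k)"] pq
        Geom_conv_cdf_decreasing[of k q t] by (simp add: algebra_simps)
    finally show ?thesis
      using pq m by (simp add: Geom_conv_cdf_Suc)
  qed
qed

section \<open>Stochastic order and equality of laws through distribution functions\<close>

lemma stoch_leI:
  assumes "\<And>t. measure_pmf.prob q {..t} \<le> measure_pmf.prob p {..t}"
  shows "stoch_le p q"
  unfolding stoch_le_def
proof
  fix t :: real
  show "measure_pmf.prob p {k. real k > t} \<le> measure_pmf.prob q {k. real k > t}"
  proof (cases "t < 0")
    case True
    then have "{k. real k > t} = UNIV"
      by (auto intro: less_le_trans)
    then show ?thesis by simp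
  next
    case False
    \<comment> \<open>An integer exceeds \<open>t\<close> iff it exceeds the floor of
      \<open>t\<close>. Negative thresholds are treated apart because \<open>nat\<close> would
      truncate their floor to 0.\<close>
    have "{k. real k > t} = UNIV - {..nat \<lfloor>t\<rfloor>}"
      using False by (auto simp: not_le) linarith+
    then show ?thesis
      using assms measure_pmf.prob_compl[of "{..nat \<lfloor>t\<rfloor>}" p]
        measure_pmf.prob_compl[of "{..nat \<lfloor>t\<rfloor>}" q] by simp
  qed
qed

lemma stoch_le_Geom_conv:
  fixes p q :: "nat \<Rightarrow> real"
  assumes "\<And>r. r < m \<Longrightarrow> 0 < p r" "\<And>r. r < m \<Longrightarrow> p r \<le> q r" "\<And>r. r < m \<Longrightarrow> q r \<le> 1"
  shows "stoch_le (Geom_conv {..<m} q) (Geom_conv {..<m} p)"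
  using assms by (intro stoch_leI Geom_conv_cdf_mono)

text \<open>Differences of consecutive values of the distribution function give the masses of finite
  points, and the mass of \<open>\<infinity>\<close> is what remains in the limit. This suits a
  running time that might a priori be infinite.\<close>

lemma prob_eqI_atMost_enat:
  fixes N Q :: "enat measure"
  assumes "prob_space N" "prob_space Q" and sets: "sets N = UNIV" "sets Q = UNIV"
    and eq: "\<And>t. measure N {..enat t} = measure Q {..enat t}"
  shows "N = Q"
proof -
  interpret N: prob_space N by fact
  interpret Q: prob_space Q by fact
  have fin: "measure N {enat t} = measure Q {enat t}" for t
  proof (cases t)
    case 0
    have "{enat 0} = {..enat 0}"
      by (auto simp: zero_enat_def[symmetric])
    then show ?thesis
      using eq[of 0] 0 by simp
  next
    case (Suc s)
    have "{enat t} = {..enat t} - {..enat s}"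
      using Suc by (auto simp: not_le less_eq_enat_def split: enat.splits)
    moreover have "{..enat s} \<subseteq> {..enat t}"
      using Suc by (auto intro: order_trans)
    ultimately show ?thesis
      using eq sets by (simp add: N.finite_measure_Diff Q.finite_measure_Diff)
  qed
  have inc: "incseq (\<lambda>t. {..enat t})"
    by (auto simp: incseq_def intro: order_trans)
  have "(\<lambda>t. measure N {..enat t}) \<longlonglongrightarrow> measure N (\<Union>t. {..enat t})"
    by (rule N.finite_Lim_measure_incseq) (auto simp: sets inc)
  moreover have "(\<lambda>t. measure Q {..enat t}) \<longlonglongrightarrow> measure Q (\<Union>t. {..enat t})"
    by (rule Q.finite_Lim_measure_incseq) (auto simp: sets inc)
  ultimately have "measure N (\<Union>t. {..enat t}) = measure Q (\<Union>t. {..enat t})"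
    unfolding eq by (rule LIMSEQ_unique)
  moreover have "{\<infinity>} = UNIV - (\<Union>t. {..enat t})"
  proof (rule set_eqI)
    show "x \<in> {\<infinity>} \<longleftrightarrow> x \<in> UNIV - (\<Union>t. {..enat t})" for x
      by (cases x) auto
  qed
  ultimately have inf: "measure N {\<infinity>} = measure Q {\<infinity>}"
    using N.prob_compl[of "\<Union>t. {..enat t}"] Q.prob_compl[of "\<Union>t. {..enat t}"] sets
      sets_eq_imp_space_eq[of N "count_space UNIV"] sets_eq_imp_space_eq[of Q "count_space UNIV"]
    by simp
  show ?thesis
  proof (rule measure_eqI_countable)
    fix a :: enat
    show "emeasure N {a} = emeasure Q {a}"
      using fin inf by (cases a) (simp_all add: N.emeasure_eq_measure Q.emeasure_eq_measure)
  qed (use sets in auto)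
qed

text \<open>Turns the infimum into a case distinction with \<open>LEAST\<close>, on which order and
  measurability arguments act directly.\<close>

lemma Inf_enat_Collect:
  "Inf {enat t | t. P t} = (if \<exists>t. P t then enat (LEAST t. P t) else \<infinity>)"
proof (cases "\<exists>t. P t")
  case True
  then have "Inf {enat t | t. P t} = enat (LEAST t. P t)"
    by (intro Inf_eqI) (auto intro: Least_le LeastI_ex)
  with True show ?thesis by simp
qed (simp add: top_enat_def)

section \<open>Move-to-front\<close>

text \<open>A list of requests runs backwards in time: its last entry is requested first.\<close>

abbreviation mtf_list :: "nat list \<Rightarrow> nat list \<Rightarrow> nat list" where
  "mtf_list us x \<equiv> foldr (\<lambda>i z. move_to_front z i) us x"

text \<open>\<open>foldr\<close> treats the last entry first. As \<open>u\<close> is indexed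
  backwards in time, \<open>u (t - 1)\<close> acts first, and each further step puts a smaller index
  at the head of the list.\<close>

lemma fmmr_Y_eq_foldr:
  "j \<le> t \<Longrightarrow> fmmr_Y \<phi> u t j x = foldr (\<lambda>i z. \<phi> z i) (map u [t - j..<t]) x"
proof (induction j)
  case (Suc j)
  then have "[t - Suc j..<t] = (t - Suc j) # [t - j..<t]"
    by (simp add: upt_conv_Cons Suc_diff_Suc)
  with Suc show ?case by simp
qed simp

text \<open>From the empty start a new record is simply put in front, because \<open>remove1\<close>
  leaves a list without it unchanged.\<close>

lemma set_distinct_mtf_list_Nil: "set (mtf_list us []) = set us \<and> distinct (mtf_list us [])"
  by (induction us) (auto simp: move_to_front_def)

lemmas set_mtf_list_Nil = set_distinct_mtf_list_Nil[THEN conjunct1]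
lemmas distinct_mtf_list_Nil = set_distinct_mtf_list_Nil[THEN conjunct2]

lemma length_mtf_list_Nil: "length (mtf_list us []) = card (set us)"
  using distinct_card[OF distinct_mtf_list_Nil] by (simp add: set_mtf_list_Nil)

lemma move_to_front_append:
  "move_to_front (xs @ ys) a = move_to_front xs a @ (if a \<in> set xs then ys else remove1 a ys)"
  by (simp add: move_to_front_def remove1_append remove1_idem)

text \<open>\<open>mtf_list us []\<close> lists the distinct entries of \<open>us\<close> in the order of their first occurrence.\<close>

lemma mtf_list_eq:
  assumes "distinct x"
  shows "mtf_list us x = mtf_list us [] @ filter (\<lambda>a. a \<notin> set us) x"
proof (induction us)
  case (Cons a us)
  \<comment> \<open>A new request takes \<open>a\<close> out of the block of unrequested records; a
    repeated one only permutes the front block.\<close>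
  have "remove1 a (filter (\<lambda>b. b \<notin> set us) x) = filter (\<lambda>b. b \<notin> set (a # us)) x"
    using assms by (auto simp: distinct_remove1_removeAll removeAll_filter_not_eq intro: filter_cong)
  moreover have "filter (\<lambda>b. b \<notin> set us) x = filter (\<lambda>b. b \<notin> set (a # us)) x" if "a \<in> set us"
    using that by (intro filter_cong) auto
  ultimately show ?case
    using Cons.IH by (cases "a \<in> set us") (simp_all add: move_to_front_append set_mtf_list_Nil)
qed simp

lemma move_to_front_perms: "x \<in> perms n \<Longrightarrow> i \<in> {1..n} \<Longrightarrow> move_to_front x i \<in> perms n"
  unfolding permutations_of_set_def move_to_front_def by (simp add: insert_absorb)

text \<open>The final list depends on the start only through the relative order of the records
  outside \<open>us\<close>, and moving \<open>i\<close> does not affect that order.\<close>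

lemma mtf_list_move_to_front:
  assumes "distinct x" "i \<in> set us"
  shows "mtf_list us (move_to_front x i) = mtf_list us x"
proof -
  have "filter (\<lambda>a. a \<notin> set us) (remove1 i x) = filter (\<lambda>a. a \<notin> set us) x"
    using assms unfolding distinct_remove1_removeAll[OF assms(1)] removeAll_filter_not_eq filter_filter
    by (intro filter_cong) auto
  moreover have "distinct (move_to_front x i)"
    using assms by (auto simp: move_to_front_def)
  ultimately show ?thesis
    using assms unfolding mtf_list_eq[OF \<open>distinct (move_to_front x i)\<close>] mtf_list_eq[OF assms(1)]
    by (simp add: move_to_front_def)
qed

text \<open>The requested records form the front block, so they can be read off from the final list
  alone.\<close>

lemma take_mtf_list:
  assumes "distinct x"
  shows "set (take (card (set us)) (mtf_list us x)) = set us"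
proof -
  have "take (card (set us)) (mtf_list us x) = mtf_list us []"
    unfolding mtf_list_eq[OF assms] length_mtf_list_Nil[symmetric] by simp
  then show ?thesis
    by (simp only: set_mtf_list_Nil)
qed

section \<open>Coalescence after \<open>n - 1\<close> distinct requests\<close>

lemma list_eqI_card_le_1:
  assumes "distinct xs" "distinct ys" "set xs = set ys" "card (set xs) \<le> 1"
  shows "xs = ys"
proof -
  have "length xs = length ys" "length xs \<le> 1"
    using assms distinct_card[OF assms(1)] distinct_card[OF assms(2)] by simp_all
  then show ?thesis
    using assms(3) by (cases xs; cases ys) auto
qed

text \<open>Final lists can differ only in the order of the records never requested. If at most one
  is left, there is no order to disagree on; if two are left, they keep the relative order they
  started with.\<close>

lemma mtf_coalescence_iff:
  assumes "set us \<subseteq> {1..n}"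
  shows "(\<forall>x\<in>perms n. \<forall>x'\<in>perms n. mtf_list us x = mtf_list us x') \<longleftrightarrow> n - 1 \<le> card (set us)"
proof
  assume card: "n - 1 \<le> card (set us)"
  have same_rest: "filter (\<lambda>a. a \<notin> set us) x = filter (\<lambda>a. a \<notin> set us) x'"
    if "x \<in> perms n" "x' \<in> perms n" for x x'
  proof (rule list_eqI_card_le_1)
    have "set (filter (\<lambda>a. a \<notin> set us) x) = {1..n} - set us"
      using that by (auto simp: permutations_of_set_def)
    then show "card (set (filter (\<lambda>a. a \<notin> set us) x)) \<le> 1"
      using card assms by (simp add: card_Diff_subset)
  qed (use that in \<open>auto simp: permutations_of_set_def\<close>)
  show "\<forall>x\<in>perms n. \<forall>x'\<in>perms n. mtf_list us x = mtf_list us x'"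
  proof (intro ballI)
    fix x x'
    assume "x \<in> perms n" "x' \<in> perms n"
    then show "mtf_list us x = mtf_list us x'"
      using same_rest[of x x'] mtf_list_eq[of x us] mtf_list_eq[of x' us]
      by (simp only: permutations_of_setD(2) simp_thms)
  qed
next
  assume *: "\<forall>x\<in>perms n. \<forall>x'\<in>perms n. mtf_list us x = mtf_list us x'"
  show "n - 1 \<le> card (set us)"
  proof (rule ccontr)
    assume "\<not> n - 1 \<le> card (set us)"
    then have "\<not> card ({1..n} - set us) \<le> Suc 0"
      using assms by (simp add: card_Diff_subset)
    then obtain a b where ab: "a \<in> {1..n} - set us" "b \<in> {1..n} - set us" "a \<noteq> b"
      by (metis card_le_Suc0_iff_eq finite_Diff finite_atLeastAtMost)
    \<comment> \<open>Any list of the remaining records completes \<open>a\<close> and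
      \<open>b\<close> to two starting permutations that differ only in the order of these
      two.\<close>
    obtain l where l: "set l = {1..n} - {a, b}" "distinct l"
      using finite_distinct_list[of "{1..n} - {a, b}"] by auto
    have perms: "a # b # l \<in> perms n" "b # a # l \<in> perms n"
    proof -
      have "set (a # b # l) = {1..n}" "set (b # a # l) = {1..n}"
        unfolding list.set l(1) using ab(1,2) by blast+
      moreover have "distinct (a # b # l)" "distinct (b # a # l)"
        using ab(3) l by auto
      ultimately show "a # b # l \<in> perms n" "b # a # l \<in> perms n"
        using permutations_of_setI by blast+
    qed
    note split = perms[THEN permutations_of_setD(2), THEN mtf_list_eq]
    have "mtf_list us [] @ filter (\<lambda>a. a \<notin> set us) (a # b # l) = mtf_list us (a # b # l)"
      by (rule split(1)[symmetric])
    also have "\<dots> = mtf_list us (b # a # l)"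
      using * perms by blast
    also have "\<dots> = mtf_list us [] @ filter (\<lambda>a. a \<notin> set us) (b # a # l)"
      by (rule split(2))
    finally show False
      using ab by simp
  qed
qed

section \<open>Path probabilities of FMMR\<close>

text \<open>The transition probability is the normalising constant of the conditional law. On a null
  conditioning event \<open>cond_pmf\<close> has an unspecified value, but then both sides
  vanish.\<close>

lemma transition_matrix_mult_cond_pmf:
  "transition_matrix \<mu> \<phi> x y * pmf (cond_pmf \<mu> {v. \<phi> x v = y}) u = (if \<phi> x u = y then pmf \<mu> u else 0)"
proof (cases "set_pmf \<mu> \<inter> {v. \<phi> x v = y} = {}")
  case True
  then have "transition_matrix \<mu> \<phi> x y = 0"
    unfolding transition_matrix_def by (subst measure_pmf_zero_iff)
  moreover have "pmf \<mu> u = 0" if "\<phi> x u = y"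
    using True that by (auto simp: pmf_eq_0_set_pmf)
  ultimately show ?thesis by simp
next
  case False
  then have "transition_matrix \<mu> \<phi> x y \<noteq> 0"
    unfolding transition_matrix_def by (subst measure_pmf_zero_iff)
  with False show ?thesis
    by (simp add: pmf_cond transition_matrix_def)
qed

text \<open>The two conditions on the support of \<open>\<pi>\<close> control the divisions by
  \<open>\<pi>\<close> in the time reversal. Countability makes every event about finite histories
  measurable and lets null histories be discarded all at once.\<close>

locale fmmr_process = prob_space M
  for M :: "'a measure" +
  fixes \<mu> :: "'u :: countable pmf" and \<phi> :: "'s :: countable \<Rightarrow> 'u \<Rightarrow> 's"
    and \<pi> :: "'s \<Rightarrow> real" and z :: 's and X :: "nat \<Rightarrow> 'a \<Rightarrow> 's" and U :: "nat \<Rightarrow> 'a \<Rightarrow> 'u"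
  assumes run: "fmmr_run \<mu> \<phi> \<pi> z M X U"
    and start_nonzero: "\<pi> z \<noteq> 0"
    and support_closed: "\<And>x u. \<pi> x \<noteq> 0 \<Longrightarrow> u \<in> set_pmf \<mu> \<Longrightarrow> \<pi> (\<phi> x u) \<noteq> 0"
begin

lemma measurable_X [measurable]: "X k \<in> measurable M (count_space UNIV)"
  using run by (simp add: fmmr_run_def)

lemma measurable_U [measurable]: "U k \<in> measurable M (count_space UNIV)"
  using run by (simp add: fmmr_run_def)

text \<open>The head is the request latest in time, so the list can be fed to \<open>foldr\<close>
  as it stands, and going further back appends at the end.\<close>

definition past :: "nat \<Rightarrow> 'a \<Rightarrow> 'u list" where
  "past t \<omega> = map (\<lambda>k. U k \<omega>) [0..<t]"

lemma past_0 [simp]: "past 0 \<omega> = []"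
  by (simp add: past_def)

lemma past_Suc: "past (Suc t) \<omega> = past t \<omega> @ [U t \<omega>]"
  by (simp add: past_def)

lemma length_past [simp]: "length (past t \<omega>) = t"
  by (simp add: past_def)

lemma past_eq_iff: "past t \<omega> = us \<longleftrightarrow> length us = t \<and> (\<forall>k<t. U k \<omega> = us ! k)"
  by (auto simp: past_def list_eq_iff_nth_eq)

lemma measurable_past [measurable]: "past t \<in> measurable M (count_space UNIV)"
  by (subst measurable_count_space_eq2_countable)
    (auto simp: vimage_def past_eq_iff Int_def conj_commute)

lemma events_past: "{\<omega> \<in> space M. P (past t \<omega>)} \<in> events"
  using measurable_sets[OF measurable_past, of "Collect P" t]
  by (simp add: vimage_def Int_def conj_commute)

lemma events_past_U: "{\<omega> \<in> space M. P (past t \<omega>) (U t \<omega>)} \<in> events"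
  using events_past[of "\<lambda>us. P (butlast us) (last us)" "Suc t"] by (simp add: past_Suc)

text \<open>The transition probability in each time-reversal factor cancels the normalisation of the
  conditional law of \<open>U k\<close>. What remains is a ratio of \<open>\<pi>\<close>-values
  times \<open>pmf \<mu> (u k)\<close>, and the ratios telescope.\<close>

lemma prob_path:
  "prob {\<omega> \<in> space M. (\<forall>k\<le>t. X k \<omega> = x k) \<and> (\<forall>k<t. U k \<omega> = u k)} =
    (if x 0 = z \<and> (\<forall>k<t. \<phi> (x (Suc k)) (u k) = x k)
     then \<pi> (x t) / \<pi> z * (\<Prod>k<t. pmf \<mu> (u k)) else 0)"
proof -
  let ?R = "\<lambda>k. time_reversal \<pi> (transition_matrix \<mu> \<phi>) (x k) (x (Suc k))"
  let ?C = "\<lambda>k. pmf (cond_pmf \<mu> {v. \<phi> (x (Suc k)) v = x k}) (u k)"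
  have step: "?R k * ?C k =
      \<pi> (x (Suc k)) / \<pi> (x k) * (if \<phi> (x (Suc k)) (u k) = x k then pmf \<mu> (u k) else 0)" for k
    unfolding time_reversal_def
    by (simp add: transition_matrix_mult_cond_pmf[of \<mu> \<phi> "x (Suc k)" "x k" "u k", symmetric])
  have product: "(\<Prod>k<t. ?R k) * (\<Prod>k<t. ?C k) = (if \<forall>k<t. \<phi> (x (Suc k)) (u k) = x k
     then \<pi> (x t) / \<pi> z * (\<Prod>k<t. pmf \<mu> (u k)) else 0)" if "x 0 = z"
  proof (induction t)
    case 0
    then show ?case using that start_nonzero by simp
  next
    case (Suc t)
    \<comment> \<open>Telescoping fails where \<open>\<pi> (x t) = 0\<close>, as the quotient is
      then 0 by convention. Since \<open>\<mu>\<close> cannot lead from the support out of it, the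
      claimed value is 0 there too.\<close>
    have *: "\<pi> (x (Suc t)) * pmf \<mu> (u t) = 0" if "\<pi> (x t) = 0" "\<phi> (x (Suc t)) (u t) = x t"
      using support_closed[of "x (Suc t)" "u t"] that by (auto simp: pmf_eq_0_set_pmf)
    have "(\<Prod>k<Suc t. ?R k) * (\<Prod>k<Suc t. ?C k) = ((\<Prod>k<t. ?R k) * (\<Prod>k<t. ?C k)) * (?R t * ?C t)"
      by (simp add: mult_ac)
    also have "\<dots> = (if \<forall>k<Suc t. \<phi> (x (Suc k)) (u k) = x k
     then \<pi> (x (Suc t)) / \<pi> z * (\<Prod>k<Suc t. pmf \<mu> (u k)) else 0)"
      unfolding Suc.IH step using * by (auto simp: less_Suc_eq)
    finally show ?case .
  qed
  have "prob {\<omega> \<in> space M. (\<forall>k\<le>t. X k \<omega> = x k) \<and> (\<forall>k<t. U k \<omega> = u k)} =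
      prob {\<omega> \<in> space M. \<forall>k\<le>t. X k \<omega> = x k} * (\<Prod>k<t. ?C k)"
    and "prob {\<omega> \<in> space M. \<forall>k\<le>t. X k \<omega> = x k} = (if x 0 = z then \<Prod>k<t. ?R k else 0)"
    using run unfolding fmmr_run_def by blast+
  with product show ?thesis
    by (cases "x 0 = z") (simp_all only: if_True if_False simp_thms mult_zero_left)
qed

text \<open>There are countably many finite histories, so almost surely none of the null ones
  occurs; \<open>prob_path\<close> shows what a history of positive probability satisfies.\<close>

lemma AE_path:
  "AE \<omega> in M. \<forall>t. X 0 \<omega> = z \<and> \<phi> (X (Suc t) \<omega>) (U t \<omega>) = X t \<omega> \<and>
     \<pi> (X t \<omega>) \<noteq> 0 \<and> U t \<omega> \<in> set_pmf \<mu>"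
proof -
  define E where "E t xs us =
    {\<omega> \<in> space M. (\<forall>k\<le>t. X k \<omega> = xs ! k) \<and> (\<forall>k<t. U k \<omega> = us ! k)}" for t xs us
  have [measurable]: "E t xs us \<in> sets M" for t xs us
    unfolding E_def by measurable
  have "AE \<omega> in M. prob (E t xs us) = 0 \<longrightarrow> \<omega> \<notin> E t xs us" for t xs us
    by (cases "prob (E t xs us) = 0") (simp_all add: prob_eq_0)
  then have "AE \<omega> in M. \<forall>t xs us. prob (E t xs us) = 0 \<longrightarrow> \<omega> \<notin> E t xs us"
    unfolding AE_all_countable by blast
  then show ?thesis
  proof (rule AE_mp, intro AE_I2 impI allI)
    fix \<omega> t
    assume \<omega>: "\<omega> \<in> space M" and null: "\<forall>t xs us. prob (E t xs us) = 0 \<longrightarrow> \<omega> \<notin> E t xs us"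
    \<comment> \<open>The history reaches one step beyond \<open>t\<close>, to contain both
      \<open>X (Suc t)\<close> and \<open>U t\<close>. That \<open>\<pi>\<close> does not vanish at
      \<open>X t\<close> then follows from \<open>support_closed\<close>.\<close>
    let ?xs = "map (\<lambda>k. X k \<omega>) [0..<Suc (Suc t)]" and ?us = "past (Suc t) \<omega>"
    have "\<omega> \<in> E (Suc t) ?xs ?us"
      using \<omega> by (auto simp: E_def past_def simp del: upt_Suc)
    then have "prob (E (Suc t) ?xs ?us) \<noteq> 0"
      using null by blast
    then have "?xs ! 0 = z \<and> (\<forall>k<Suc t. \<phi> (?xs ! Suc k) (?us ! k) = ?xs ! k)
        \<and> \<pi> (?xs ! Suc t) \<noteq> 0 \<and> (\<forall>k<Suc t. pmf \<mu> (?us ! k) \<noteq> 0)"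
      unfolding E_def prob_path by (auto split: if_splits simp del: upt_Suc prod.lessThan_Suc)
    then have "X 0 \<omega> = z" "\<phi> (X (Suc t) \<omega>) (U t \<omega>) = X t \<omega>" "\<pi> (X (Suc t) \<omega>) \<noteq> 0"
        "U t \<omega> \<in> set_pmf \<mu>"
      by (auto simp: past_def set_pmf_iff simp del: upt_Suc)
    then show "X 0 \<omega> = z \<and> \<phi> (X (Suc t) \<omega>) (U t \<omega>) = X t \<omega> \<and> \<pi> (X t \<omega>) \<noteq> 0 \<and> U t \<omega> \<in> set_pmf \<mu>"
      using support_closed by metis
  qed
qed

text \<open>The earliest state and the requests almost surely determine the whole path, so the event
  reduces to a single path.\<close>

lemma prob_past_state:
  assumes "length us = t"
  shows "prob {\<omega> \<in> space M. past t \<omega> = us \<and> X t \<omega> = s} =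
    (if foldr (\<lambda>i x. \<phi> x i) us s = z then \<pi> s / \<pi> z * prod_list (map (pmf \<mu>) us) else 0)"
proof -
  \<comment> \<open>\<open>x k\<close> is the state at time \<open>-k\<close>, reached from
    \<open>s\<close> by the requests \<open>us ! (t - 1)\<close> down to
    \<open>us ! k\<close>.\<close>
  define x where "x k = foldr (\<lambda>i x. \<phi> x i) (drop k us) s" for k
  have x_Suc: "\<phi> (x (Suc k)) (us ! k) = x k" if "k < t" for k
    using that assms by (simp add: x_def Cons_nth_drop_Suc[symmetric])
  have x_t: "x t = s"
    using assms by (simp add: x_def)
  have "prob {\<omega> \<in> space M. past t \<omega> = us \<and> X t \<omega> = s} =
      prob {\<omega> \<in> space M. (\<forall>k\<le>t. X k \<omega> = x k) \<and> (\<forall>k<t. U k \<omega> = us ! k)}"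
  proof (intro finite_measure_eq_AE)
    show "AE \<omega> in M. \<omega> \<in> {\<omega> \<in> space M. past t \<omega> = us \<and> X t \<omega> = s} \<longleftrightarrow>
        \<omega> \<in> {\<omega> \<in> space M. (\<forall>k\<le>t. X k \<omega> = x k) \<and> (\<forall>k<t. U k \<omega> = us ! k)}"
      using AE_path
    proof (rule AE_mp, intro AE_I2 impI)
      fix \<omega>
      assume *: "\<forall>t. X 0 \<omega> = z \<and> \<phi> (X (Suc t) \<omega>) (U t \<omega>) = X t \<omega> \<and>
        \<pi> (X t \<omega>) \<noteq> 0 \<and> U t \<omega> \<in> set_pmf \<mu>"
      have "X k \<omega> = x k" if "k \<le> t" "\<forall>k<t. U k \<omega> = us ! k" "X t \<omega> = s" for k
        using that(1)
      proof (induction k rule: inc_induct)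
        case base
        then show ?case using that x_t by simp
      next
        case (step k)
        then have "X k \<omega> = \<phi> (x (Suc k)) (us ! k)"
          using * that(2) by metis
        then show ?case
          using step x_Suc by simp
      qed
      then show "\<omega> \<in> {\<omega> \<in> space M. past t \<omega> = us \<and> X t \<omega> = s} \<longleftrightarrow>
        \<omega> \<in> {\<omega> \<in> space M. (\<forall>k\<le>t. X k \<omega> = x k) \<and> (\<forall>k<t. U k \<omega> = us ! k)}"
        using assms x_t by (auto simp: past_eq_iff)
    qed
  qed measurable
  also have "\<dots> = (if x 0 = z then \<pi> s / \<pi> z * (\<Prod>k<t. pmf \<mu> (us ! k)) else 0)"
    using x_Suc x_t by (simp add: prob_path)
  also have "(\<Prod>k<t. pmf \<mu> (us ! k)) = prod_list (map (pmf \<mu>) us)"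
    using assms by (simp add: prod.list_conv_set_nth atLeast0LessThan)
  finally show ?thesis
    by (simp add: x_def)
qed

text \<open>Summation over the state \<open>X t\<close>, which almost surely lies in the finite
  support \<open>S\<close>.\<close>

lemma prob_past:
  assumes "finite S" "\<And>s. \<pi> s \<noteq> 0 \<longleftrightarrow> s \<in> S" "length us = t"
  shows "prob {\<omega> \<in> space M. past t \<omega> = us} =
    (\<Sum>s \<in> {s \<in> S. foldr (\<lambda>i x. \<phi> x i) us s = z}. \<pi> s / \<pi> z * prod_list (map (pmf \<mu>) us))"
proof -
  have "prob {\<omega> \<in> space M. past t \<omega> = us} =
      (\<Sum>s\<in>S. prob {\<omega> \<in> space M. past t \<omega> = us \<and> X t \<omega> = s})"
  proof (rule prob_sum)
    show "AE \<omega> in M. (\<forall>s\<in>S. past t \<omega> = us \<and> X t \<omega> = s \<longrightarrow> past t \<omega> = us) \<and>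
        (past t \<omega> = us \<longrightarrow> (\<exists>!s\<in>S. past t \<omega> = us \<and> X t \<omega> = s))"
      using AE_path by (rule AE_mp) (auto simp: assms(2))
  qed (use assms in measurable)
  also have "\<dots> = (\<Sum>s \<in> {s \<in> S. foldr (\<lambda>i x. \<phi> x i) us s = z}. \<pi> s / \<pi> z * prod_list (map (pmf \<mu>) us))"
    using assms by (simp add: prob_past_state sum.inter_filter del: times_divide_eq_left)
  finally show ?thesis .
qed

end

section \<open>The running time for move-to-front\<close>

text \<open>Entries are distinct, so the partial sum is the weight of a set. This is what links it
  to the set of requested records.\<close>

lemma yw_plus_eq_sum_take:
  assumes "distinct z" "r \<le> length z"
  shows "yw_plus w z r = sum w (set (take r z))"
proof -
  have "yw_plus w z r = (\<Sum>k<r. w (z ! k))"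
    unfolding yw_plus_def yw_def
    by (rule sum.reindex_bij_witness[of _ Suc "\<lambda>j. j - 1"]) auto
  also have "\<dots> = sum_list (map w (take r z))"
    using assms by (simp add: sum.list_conv_set_nth atLeast0LessThan)
  also have "\<dots> = sum w (set (take r z))"
    using assms by (simp add: sum_list_distinct_conv_sum_set)
  finally show ?thesis .
qed

section \<open>Weights of the initial segments of a permutation\<close>

locale mtf_weights =
  fixes n :: nat and w :: "nat \<Rightarrow> real"
  assumes positive: "\<And>i. 1 \<le> i \<Longrightarrow> i \<le> n \<Longrightarrow> 0 < w i"
    and total: "(\<Sum>i=1..n. w i) = 1"
begin

lemma pmf_request: "pmf (request_pmf n w) i = (if i \<in> {1..n} then w i else 0)"
  unfolding request_pmf_def
proof (rule pmf_embed_pmf)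
  show "0 \<le> (if i \<in> {1..n} then w i else 0)" for i
    using positive by (auto intro: less_imp_le)
  have "(\<integral>\<^sup>+ i. ennreal (if i \<in> {1..n} then w i else 0) \<partial>count_space UNIV) =
      (\<Sum>i\<in>{1..n}. ennreal (w i))"
    by (subst nn_integral_count_space'[of "{1..n}"]) auto
  also have "\<dots> = 1"
    using positive total by (subst sum_ennreal) (auto intro: less_imp_le)
  finally show "(\<integral>\<^sup>+ i. ennreal (if i \<in> {1..n} then w i else 0) \<partial>count_space UNIV) = 1" .
qed

lemma set_request: "set_pmf (request_pmf n w) = {1..n}"
proof -
  have "w i \<noteq> 0" if "i \<in> {1..n}" for i
    using positive[of i] that by auto
  then show ?thesis
    by (auto simp: set_pmf_iff pmf_request split: if_splits)
qed

text \<open>On a permutation every factor is a quotient of positive numbers. This identifies the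
  support for use in \<open>fmmr_process\<close>.\<close>

lemma mtf_stationary_nonzero_iff: "mtf_stationary n w z \<noteq> 0 \<longleftrightarrow> z \<in> perms n"
proof
  assume z: "z \<in> perms n"
  have yw: "0 < yw w z r" if "r \<in> {1..n}" for r
  proof -
    have "z ! (r - 1) \<in> set z"
      using z that by (intro nth_mem) (auto simp: length_finite_permutations_of_set)
    then show ?thesis
      using z positive by (auto simp: yw_def permutations_of_set_def)
  qed
  have "0 < (\<Prod>r=1..n. yw w z r / (\<Sum>j=r..n. yw w z j))"
    using yw by (intro prod_pos divide_pos_pos sum_pos ballI) auto
  then show "mtf_stationary n w z \<noteq> 0"
    using z by (simp only: mtf_stationary_def if_True)
qed (metis mtf_stationary_def)

lemma sum_weights_nonneg: "A \<subseteq> {1..n} \<Longrightarrow> 0 \<le> sum w A"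
proof (rule sum_nonneg)
  fix i
  assume "A \<subseteq> {1..n}" "i \<in> A"
  then have "i \<in> {1..n}"
    by (rule subsetD)
  then show "0 \<le> w i"
    using positive[of i] by simp
qed

lemma yw_plus_eq_sum:
  assumes "z \<in> perms n" "r \<le> n"
  shows "yw_plus w z r = sum w (set (take r z))"
  using assms by (intro yw_plus_eq_sum_take permutations_of_setD(2)) (simp_all add: length_finite_permutations_of_set)

lemma take_perms_subset: "z \<in> perms n \<Longrightarrow> set (take r z) \<subseteq> {1..n}"
  using set_take_subset[of r z] by (simp only: permutations_of_setD(1))

lemma card_take_perms:
  assumes "z \<in> perms n" "r \<le> n"
  shows "card (set (take r z)) = r"
proof -
  have "distinct (take r z)" "length (take r z) = r"
    using assms by (simp_all add: permutations_of_setD(2) length_finite_permutations_of_set)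
  then show ?thesis
    by (simp only: distinct_card)
qed

lemma yw_plus_nonneg: "z \<in> perms n \<Longrightarrow> r \<le> n \<Longrightarrow> 0 \<le> yw_plus w z r"
  using sum_weights_nonneg[OF take_perms_subset] by (simp only: yw_plus_eq_sum)

text \<open>Some record lies outside the first \<open>r\<close> and has positive weight. Hence all
  success probabilities are positive.\<close>

lemma yw_plus_less_1:
  assumes "z \<in> perms n" "r < n"
  shows "yw_plus w z r < 1"
proof -
  have "set (take r z) \<noteq> {1..n}"
    using card_take_perms[of z r] assms by auto
  then have "0 < sum w ({1..n} - set (take r z))"
    using take_perms_subset[of z r] assms positive by (intro sum_pos) auto
  then show ?thesis
    using assms total take_perms_subset[of z r]
    by (simp add: yw_plus_eq_sum sum_diff)
qed

end

section \<open>The number of distinct requests\<close>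

locale mtf_process = mtf_weights n w +
  fmmr_process M "request_pmf n w" move_to_front "mtf_stationary n w" z X U
  for n w and M :: "'a measure" and z X U +
  assumes z: "z \<in> perms n"
begin

lemma prob_past_mtf:
  assumes "length us = t"
  shows "prob {\<omega> \<in> space M. past t \<omega> = us} = (\<Sum>s \<in> {s \<in> perms n. mtf_list us s = z}.
    mtf_stationary n w s / mtf_stationary n w z * prod_list (map (pmf (request_pmf n w)) us))"
  using assms by (intro prob_past mtf_stationary_nonzero_iff finite_permutations_of_set finite_atLeastAtMost)

text \<open>Requesting \<open>i\<close> before \<open>us\<close>, in forward time, does not change the final list, since \<open>us\<close>
  requests \<open>i\<close> again.\<close>

lemma prob_past_repeat:
  assumes "length us = t" "set us \<subseteq> {1..n}" "i \<in> set us"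
  shows "prob {\<omega> \<in> space M. past (Suc t) \<omega> = us @ [i]} = w i * prob {\<omega> \<in> space M. past t \<omega> = us}"
proof -
  have "{s \<in> perms n. mtf_list (us @ [i]) s = z} = {s \<in> perms n. mtf_list us s = z}"
    using mtf_list_move_to_front[OF permutations_of_setD(2) assms(3)] by auto
  moreover have "pmf (request_pmf n w) i = w i"
    using assms by (auto simp: pmf_request)
  ultimately show ?thesis
    using assms by (simp add: prob_past_mtf sum_distrib_left mult_ac)
qed

lemma AE_U_range: "AE \<omega> in M. \<forall>t. U t \<omega> \<in> {1..n}"
  using AE_path by (rule AE_mp) (simp add: set_request)

text \<open>Given a history \<open>us\<close>, a repetition has probability
  \<open>sum w (set us)\<close>. Histories of positive probability with \<open>m\<close> distinct
  requests all have the same request set, the first \<open>m\<close> records of \<open>z\<close>, so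
  this probability is common to them.\<close>

lemma prob_repeat:
  assumes "m \<le> n"
  shows "prob {\<omega> \<in> space M. card (set (past t \<omega>)) = m \<and> U t \<omega> \<in> set (past t \<omega>)} =
    yw_plus w z m * prob {\<omega> \<in> space M. card (set (past t \<omega>)) = m}"
proof -
  define F where "F = {us. set us \<subseteq> {1..n} \<and> length us = t \<and> card (set us) = m}"
  have fin: "finite F"
    unfolding F_def
    by (rule finite_subset[OF _ finite_lists_length_eq[of "{1..n}" t]]) auto
  have past_range: "AE \<omega> in M. set (past t \<omega>) \<subseteq> {1..n}"
    using AE_U_range by (rule AE_mp) (auto simp: past_def)
  have eq1: "prob {\<omega> \<in> space M. card (set (past t \<omega>)) = m} =
      (\<Sum>us\<in>F. prob {\<omega> \<in> space M. past t \<omega> = us})"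
  proof (rule prob_sum)
    show "AE \<omega> in M. (\<forall>us\<in>F. past t \<omega> = us \<longrightarrow> card (set (past t \<omega>)) = m) \<and>
        (card (set (past t \<omega>)) = m \<longrightarrow> (\<exists>!us\<in>F. past t \<omega> = us))"
      using past_range by (rule AE_mp) (auto simp: F_def)
  qed (rule fin events_past)+
  have "prob {\<omega> \<in> space M. card (set (past t \<omega>)) = m \<and> U t \<omega> \<in> set (past t \<omega>)} =
      (\<Sum>v\<in>Sigma F set. prob {\<omega> \<in> space M. past (Suc t) \<omega> = fst v @ [snd v]})"
  proof (rule prob_sum)
    have past_iff: "past (Suc t) \<omega> = fst v @ [snd v] \<longleftrightarrow> v = (past t \<omega>, U t \<omega>)" for v \<omega>
      by (auto simp: past_Suc)
    show "AE \<omega> in M. (\<forall>v\<in>Sigma F set. past (Suc t) \<omega> = fst v @ [snd v] \<longrightarrow>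
          card (set (past t \<omega>)) = m \<and> U t \<omega> \<in> set (past t \<omega>)) \<and>
        (card (set (past t \<omega>)) = m \<and> U t \<omega> \<in> set (past t \<omega>) \<longrightarrow>
          (\<exists>!v\<in>Sigma F set. past (Suc t) \<omega> = fst v @ [snd v]))"
      using past_range unfolding past_iff by (rule AE_mp) (auto simp: F_def)
    show "finite (Sigma F set)"
      using fin by (rule finite_SigmaI) simp
  qed (rule events_past events_past_U)+
  also have "\<dots> = (\<Sum>us\<in>F. \<Sum>i\<in>set us. prob {\<omega> \<in> space M. past (Suc t) \<omega> = us @ [i]})"
    using fin by (simp add: sum.Sigma split_def)
  also have "\<dots> = (\<Sum>us\<in>F. yw_plus w z m * prob {\<omega> \<in> space M. past t \<omega> = us})"
  proof (rule sum.cong[OF refl])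
    fix us
    assume us: "us \<in> F"
    let ?p = "prob {\<omega> \<in> space M. past t \<omega> = us}"
    have "(\<Sum>i\<in>set us. prob {\<omega> \<in> space M. past (Suc t) \<omega> = us @ [i]}) = (\<Sum>i\<in>set us. w i * ?p)"
      using us by (intro sum.cong prob_past_repeat) (auto simp: F_def)
    also have "\<dots> = sum w (set us) * ?p"
      by (simp add: sum_distrib_right)
    also have "\<dots> = yw_plus w z m * ?p"
    proof (cases "?p = 0")
      case False
      have us_props: "length us = t" "card (set us) = m"
        using us by (simp_all add: F_def)
      \<comment> \<open>Positive probability supplies a state that \<open>us\<close> carries to
        \<open>z\<close>, so the front block of \<open>z\<close> is known.\<close>
      have "{s \<in> perms n. mtf_list us s = z} \<noteq> {}"
        using False unfolding prob_past_mtf[OF us_props(1)] by (metis (no_types) sum.empty)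
      then obtain s where s: "s \<in> perms n" "mtf_list us s = z"
        by blast
      have "set (take m z) = set us"
        using take_mtf_list[OF permutations_of_setD(2)[OF s(1)], of us] unfolding s(2) us_props(2) .
      then show ?thesis
        using assms z by (simp add: yw_plus_eq_sum)
    qed simp
    finally show "(\<Sum>i\<in>set us. prob {\<omega> \<in> space M. past (Suc t) \<omega> = us @ [i]}) = yw_plus w z m * ?p" .
  qed
  finally show ?thesis
    by (simp add: eq1 sum_distrib_left)
qed

text \<open>Both sides obey the recurrence of \<open>Geom_conv_cdf_Suc\<close> with the same
  boundary values: stage \<open>r\<close> ends when a new record follows \<open>r\<close> distinct
  ones.\<close>

lemma prob_distinct_requests:
  assumes "m < n"
  shows "prob {\<omega> \<in> space M. m \<le> card (set (past t \<omega>))} =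
    measure_pmf.prob (Geom_conv {..<m} (\<lambda>r. 1 - yw_plus w z r)) {..t}"
  using assms
proof (induction t arbitrary: m)
  case 0
  show ?case
  proof (cases m)
    case 0
    then show ?thesis by (simp add: Geom_conv_empty prob_space)
  next
    case (Suc k)
    then have "prob {\<omega> \<in> space M. m \<le> card (set (past 0 \<omega>))} = 0"
      by simp
    with Suc show ?thesis
      by (simp only: Geom_conv_cdf_0)
  qed
next
  case (Suc t)
  show ?case
  proof (cases m)
    case 0
    then show ?thesis by (simp add: Geom_conv_empty prob_space)
  next
    case m: (Suc k)
    let ?A = "\<lambda>m. {\<omega> \<in> space M. m \<le> card (set (past t \<omega>))}"
    let ?C = "{\<omega> \<in> space M. card (set (past t \<omega>)) = k}"
    let ?D = "{\<omega> \<in> space M. card (set (past t \<omega>)) = k \<and> U t \<omega> \<in> set (past t \<omega>)}"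
    let ?y = "yw_plus w z k"
    \<comment> \<open>Either \<open>Suc k\<close> distinct records were present before, or exactly
      \<open>k\<close> were and the additional request is new.\<close>
    have "{\<omega> \<in> space M. m \<le> card (set (past (Suc t) \<omega>))} = ?A (Suc k) \<union> (?C - ?D)"
      using m by (auto simp: past_Suc card_insert_if)
    moreover have "prob (?A (Suc k) \<union> (?C - ?D)) = prob (?A (Suc k)) + prob (?C - ?D)"
      by (rule finite_measure_Union) auto
    moreover have "prob (?C - ?D) = prob ?C - prob ?D"
      by (rule finite_measure_Diff) auto
    moreover have "prob ?D = ?y * prob ?C"
      using Suc.prems m by (intro prob_repeat) auto
    moreover have "?C = ?A k - ?A (Suc k)"
      by auto
    moreover have "prob (?A k - ?A (Suc k)) = prob (?A k) - prob (?A (Suc k))"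
      by (rule finite_measure_Diff) auto
    ultimately have "prob {\<omega> \<in> space M. m \<le> card (set (past (Suc t) \<omega>))} =
        (1 - ?y) * prob (?A k) + ?y * prob (?A (Suc k))"
      by (simp add: algebra_simps)
    then show ?thesis
      using Suc.IH[of k] Suc.IH[of "Suc k"] Suc.prems m z
        Geom_conv_cdf_Suc[of "\<lambda>r. 1 - yw_plus w z r" k t] yw_plus_less_1[of z k] yw_plus_nonneg[of z k]
      by simp
  qed
qed

section \<open>From distinct requests to the running time\<close>

lemma fmmr_time_le_iff:
  assumes "\<forall>k. U k \<omega> \<in> {1..n}"
  shows "fmmr_time (perms n) move_to_front (\<lambda>k. U k \<omega>) \<le> enat t \<longleftrightarrow> n - 1 \<le> card (set (past t \<omega>))"
proof -
  have "fmmr_Y move_to_front (\<lambda>k. U k \<omega>) s s x = mtf_list (past s \<omega>) x" for s x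
    by (simp add: fmmr_Y_eq_foldr past_def)
  moreover have "set (past s \<omega>) \<subseteq> {1..n}" for s
    unfolding past_def using assms by auto
  ultimately have coal: "(\<forall>x\<in>perms n. \<forall>x'\<in>perms n. fmmr_Y move_to_front (\<lambda>k. U k \<omega>) s s x =
      fmmr_Y move_to_front (\<lambda>k. U k \<omega>) s s x') \<longleftrightarrow> n - 1 \<le> card (set (past s \<omega>))" for s
    by (simp only: mtf_coalescence_iff)
  \<comment> \<open>Distinct requests only accumulate, so coalescence persists: the first such time
    is at most \<open>t\<close> iff the condition holds at \<open>t\<close>.\<close>
  have mono: "card (set (past s \<omega>)) \<le> card (set (past t \<omega>))" if "s \<le> t" for s
    using that by (intro card_mono) (auto simp: past_def)
  let ?P = "\<lambda>s. n - 1 \<le> card (set (past s \<omega>))"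
  show ?thesis
    unfolding fmmr_time_def coal Inf_enat_Collect
  proof (cases "\<exists>s. ?P s")
    case True
    then have "?P (LEAST s. ?P s)"
      by (rule LeastI_ex)
    then show "(if \<exists>s. ?P s then enat (LEAST s. ?P s) else \<infinity>) \<le> enat t \<longleftrightarrow> ?P t"
      using True mono by (auto intro: Least_le order_trans)
  qed auto
qed

lemma measurable_fmmr_time [measurable]:
  "(\<lambda>\<omega>. fmmr_time S \<psi> (\<lambda>k. U k \<omega>)) \<in> measurable M (count_space UNIV)"
proof -
  let ?C = "\<lambda>us. \<forall>x\<in>S. \<forall>x'\<in>S. foldr (\<lambda>i y. \<psi> y i) us x = foldr (\<lambda>i y. \<psi> y i) us x'"
  have [measurable]: "Measurable.pred M (\<lambda>\<omega>. ?C (past t \<omega>))" for t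
    unfolding pred_def by (rule events_past)
  have "fmmr_Y \<psi> (\<lambda>k. U k \<omega>) t t x = foldr (\<lambda>i y. \<psi> y i) (past t \<omega>) x" for t x \<omega>
    by (simp add: fmmr_Y_eq_foldr past_def)
  then have "fmmr_time S \<psi> (\<lambda>k. U k \<omega>) =
      (if \<exists>t. ?C (past t \<omega>) then enat (LEAST t. ?C (past t \<omega>)) else \<infinity>)" for \<omega>
    by (simp only: fmmr_time_def Inf_enat_Collect)
  then show ?thesis
    by (simp only:) measurable
qed

lemma distr_fmmr_time:
  "distr M (count_space UNIV) (\<lambda>\<omega>. fmmr_time (perms n) move_to_front (\<lambda>k. U k \<omega>)) =
    measure_pmf (map_pmf enat (law_T n w z))"
proof (rule prob_eqI_atMost_enat)
  let ?T = "\<lambda>\<omega>. fmmr_time (perms n) move_to_front (\<lambda>k. U k \<omega>)"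
  \<comment> \<open>Total weight 1 excludes \<open>n = 0\<close>. Hence \<open>n - 1 < n\<close>,
    and \<open>prob_distinct_requests\<close> applies with \<open>m = n - 1\<close>.\<close>
  have n: "0 < n"
    using total by (cases n) auto
  show "prob_space (distr M (count_space UNIV) ?T)"
    by (rule prob_space_distr) measurable
  fix t
  have "measure (distr M (count_space UNIV) ?T) {..enat t} = prob {\<omega> \<in> space M. ?T \<omega> \<le> enat t}"
    by (subst measure_distr) (auto simp: vimage_def Int_def conj_commute)
  also have "\<dots> = prob {\<omega> \<in> space M. n - 1 \<le> card (set (past t \<omega>))}"
  proof (rule finite_measure_eq_AE)
    show "AE \<omega> in M. \<omega> \<in> {\<omega> \<in> space M. ?T \<omega> \<le> enat t} \<longleftrightarrow>
        \<omega> \<in> {\<omega> \<in> space M. n - 1 \<le> card (set (past t \<omega>))}"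
      using AE_U_range by (rule AE_mp) (intro AE_I2 impI, simp only: fmmr_time_le_iff mem_Collect_eq simp_thms)
  qed measurable
  also have "\<dots> = measure_pmf.prob (law_T n w z) {..t}"
    using n by (simp add: prob_distinct_requests law_T_def)
  also have "\<dots> = measure_pmf.prob (map_pmf enat (law_T n w z)) {..enat t}"
    by (simp add: vimage_def atMost_def)
  finally show "measure (distr M (count_space UNIV) ?T) {..enat t} =
    measure_pmf.prob (map_pmf enat (law_T n w z)) {..enat t}" .
qed (rule measure_pmf.prob_space_axioms, simp_all)

end

section \<open>Monotonicity in the initial state\<close>

context mtf_weights
begin

text \<open>Smaller partial sums mean larger success probabilities in every stage.\<close>

lemma law_T_antimono:
  assumes "z \<in> perms n" "z' \<in> perms n" "\<And>r. r < n \<Longrightarrow> yw_plus w z' r \<le> yw_plus w z r"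
  shows "stoch_le (law_T n w z') (law_T n w z)"
  unfolding law_T_def
proof (rule stoch_le_Geom_conv)
  fix r
  assume "r < n - 1"
  then have r: "r < n" by simp
  show "0 < 1 - yw_plus w z r"
    using yw_plus_less_1[OF assms(1) r] by simp
  show "1 - yw_plus w z r \<le> 1 - yw_plus w z' r"
    using assms(3)[OF r] by simp
  show "1 - yw_plus w z' r \<le> 1"
    using yw_plus_nonneg[OF assms(2), of r] r by simp
qed

end

section \<open>Extreme initial segments\<close>

lemma set_take_id:
  assumes "r \<le> n"
  shows "set (take r [1..<Suc n]) = {1..r}"
proof -
  have "take r [1..<Suc n] = [1..<1 + r]"
    using assms by (intro take_upt) simp
  then show ?thesis
    by (simp only: set_upt) auto
qed

lemma set_take_rev:
  assumes "r \<le> n"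
  shows "set (take r (rev [1..<Suc n])) = {Suc (n - r)..n}"
proof -
  have "take r (rev [1..<Suc n]) = rev [Suc (n - r)..<Suc n]"
    using assms by (simp add: take_rev drop_upt del: upt_Suc)
  then show ?thesis
    by (simp only: set_rev set_upt) auto
qed

lemma id_perms: "[1..<Suc n] \<in> perms n"
  by (rule permutations_of_setI) (auto simp del: upt_Suc)

lemma rev_perms: "rev [1..<Suc n] \<in> perms n"
  by (rule permutations_of_setI) (auto simp del: upt_Suc)

locale decreasing_weights = mtf_weights +
  assumes decreasing: "\<And>i j. 1 \<le> i \<Longrightarrow> i \<le> j \<Longrightarrow> j \<le> n \<Longrightarrow> w j \<le> w i"
begin

text \<open>Exchange argument with \<open>k = card A\<close>: the parts of \<open>A\<close> and of
  \<open>{1..k}\<close> outside each other have equally many elements, and \<open>w k\<close>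
  separates their weights.\<close>

lemma sum_le_w_plus:
  assumes "A \<subseteq> {1..n}"
  shows "sum w A \<le> w_plus w (card A)"
proof -
  define k where "k = card A"
  have fin: "finite A"
    using assms finite_subset by blast
  have k: "k \<le> n"
    using card_mono[OF _ assms] by (simp add: k_def)
  have "card (A - {1..k}) = card ({1..k} - A)"
    using fin card_Diff_subset_Int[of A "{1..k}"] card_Diff_subset_Int[of "{1..k}" A]
    by (simp add: k_def Int_commute)
  moreover have "sum w (A - {1..k}) \<le> real (card (A - {1..k})) * w k"
  proof (rule sum_bounded_above)
    fix i
    assume i: "i \<in> A - {1..k}"
    then have "i \<in> {1..n}"
      using assms by blast
    moreover have "1 \<le> k"
      using i fin by (auto simp: k_def Suc_le_eq card_gt_0_iff)
    ultimately show "w i \<le> w k"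
      using i by (intro decreasing) auto
  qed
  moreover have "real (card ({1..k} - A)) * w k \<le> sum w ({1..k} - A)"
    using k by (intro sum_bounded_below decreasing) auto
  ultimately have "sum w (A - {1..k}) \<le> sum w ({1..k} - A)"
    by simp
  moreover have "sum w A = sum w (A \<inter> {1..k}) + sum w (A - {1..k})"
    using fin by (rule sum.Int_Diff)
  moreover have "sum w {1..k} = sum w ({1..k} \<inter> A) + sum w ({1..k} - A)"
    by (intro sum.Int_Diff) simp
  ultimately show ?thesis
    by (simp add: w_plus_def k_def Int_commute)
qed

text \<open>The upper bound applied to the complement of \<open>A\<close>.\<close>

lemma sum_ge_w_plus:
  assumes "A \<subseteq> {1..n}"
  shows "1 - w_plus w (n - card A) \<le> sum w A"
proof -
  have "sum w ({1..n} - A) = 1 - sum w A"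
    using assms total by (simp add: sum_diff)
  moreover have "card ({1..n} - A) = n - card A"
    using assms finite_subset[OF assms] by (simp add: card_Diff_subset)
  ultimately show ?thesis
    using sum_le_w_plus[of "{1..n} - A"] by simp
qed

lemma yw_plus_id: "r \<le> n \<Longrightarrow> yw_plus w [1..<Suc n] r = w_plus w r"
  using yw_plus_eq_sum[OF id_perms] by (simp only: set_take_id w_plus_def)

lemma yw_plus_rev:
  assumes "r \<le> n"
  shows "yw_plus w (rev [1..<Suc n]) r = 1 - w_plus w (n - r)"
proof -
  have "sum w ({1..n - r} \<union> {Suc (n - r)..n}) = sum w {1..n - r} + sum w {Suc (n - r)..n}"
    by (rule sum.union_disjoint) auto
  moreover have "{1..n - r} \<union> {Suc (n - r)..n} = {1..n}"
    by auto
  ultimately have "sum w {Suc (n - r)..n} = 1 - sum w {1..n - r}"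
    using total by simp
  then show ?thesis
    using yw_plus_eq_sum[OF rev_perms assms] by (simp only: set_take_rev[OF assms] w_plus_def)
qed

section \<open>Partial sums along the Bruhat order\<close>

lemma bruhat_step_perms:
  assumes "bruhat_step z z'" "z \<in> perms n"
  shows "z' \<in> perms n"
proof -
  obtain i j where ij: "i < j" "j < length z" "z' = z[i := z ! j, j := z ! i]"
    using assms(1) by (auto simp: bruhat_step_def)
  show ?thesis
  proof (rule permutations_of_setI)
    show "set z' = {1..n}"
      using ij assms(2) by (simp add: set_swap permutations_of_setD)
    show "distinct z'"
      using ij assms(2) by (simp add: distinct_swap permutations_of_setD)
  qed
qed

text \<open>If both swapped positions are among the first \<open>r\<close>, the set of the first
  \<open>r\<close> records is unchanged. Otherwise only position \<open>i\<close> can be among them,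
  and it receives a larger record, whose weight is no greater.\<close>

lemma bruhat_step_yw_plus:
  assumes "bruhat_step z z'" "z \<in> perms n" "r \<le> n"
  shows "yw_plus w z' r \<le> yw_plus w z r"
proof -
  obtain i j where ij: "i < j" "j < length z" "z ! i < z ! j" "z' = z[i := z ! j, j := z ! i]"
    using assms(1) by (auto simp: bruhat_step_def)
  have len: "length z = n" "length z' = n"
    using assms(2) bruhat_step_perms[OF assms(1,2)]
    by (simp_all add: length_finite_permutations_of_set)
  have "z ! i \<in> {1..n}" "z ! j \<in> {1..n}"
    using nth_mem[of i z] nth_mem[of j z] ij permutations_of_setD(1)[OF assms(2)] by auto
  then have swap: "w (z ! j) \<le> w (z ! i)"
    using ij by (intro decreasing) auto
  show ?thesis
  proof (cases "j < r")
    case True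
    then have "take r z' = (take r z)[i := take r z ! j, j := take r z ! i]"
      using ij by (simp add: take_update_swap)
    then have "set (take r z') = set (take r z)"
      using True ij len set_swap[of i "take r z" j] by (simp only:) simp
    then show ?thesis
      using assms bruhat_step_perms[OF assms(1,2)] by (simp add: yw_plus_eq_sum)
  next
    case False
    then have "w (z' ! (k - 1)) \<le> w (z ! (k - 1))" if "k \<in> {1..r}" for k
      using that swap ij by (auto simp: nth_list_update)
    then show ?thesis
      unfolding yw_plus_def yw_def by (rule sum_mono)
  qed
qed

lemma bruhat_le_yw_plus:
  assumes "bruhat_le z z'" "z \<in> perms n" "r \<le> n"
  shows "yw_plus w z' r \<le> yw_plus w z r"
proof -
  have "z' \<in> perms n \<and> yw_plus w z' r \<le> yw_plus w z r"
    using assms(1) unfolding bruhat_le_def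
  proof (induction rule: rtranclp_induct)
    case (step x y)
    then show ?case
      using bruhat_step_perms bruhat_step_yw_plus[of x y r] assms(3) by (auto intro: order_trans)
  qed (use assms in simp)
  then show ?thesis ..
qed

section \<open>The laws at the two extreme permutations\<close>

lemma law_T_id: "law_T n w [1..<Suc n] = Geom_conv {..<n - 1} (\<lambda>r. 1 - w_plus w r)"
  unfolding law_T_def by (rule Geom_conv_cong) (subst yw_plus_id, simp_all)

text \<open>Under \<open>rev\<close> the first \<open>r\<close> records are the complement of
  \<open>{1..n - r}\<close>, so stage \<open>r\<close> has success probability
  \<open>w_plus w (n - r)\<close>; \<open>n - r\<close> runs through 2 to \<open>n\<close>.\<close>

lemma law_T_rev: "law_T n w (rev [1..<Suc n]) = Geom_conv {2..n} (w_plus w)"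
proof -
  have "law_T n w (rev [1..<Suc n]) = Geom_conv {..<n - 1} (\<lambda>r. w_plus w (n - r))"
    unfolding law_T_def by (rule Geom_conv_cong) (subst yw_plus_rev, simp_all)
  also have "\<dots> = Geom_conv ((\<lambda>r. n - r) ` {..<n - 1}) (w_plus w)"
    by (rule Geom_conv_reindex[symmetric]) (auto simp: inj_on_def)
  also have "(\<lambda>r. n - r) ` {..<n - 1} = {2..n}"
  proof (intro equalityI subsetI)
    show "x \<in> (\<lambda>r. n - r) ` {..<n - 1}" if "x \<in> {2..n}" for x
      using that by (intro image_eqI[where x="n - x"]) auto
  qed auto
  finally show ?thesis .
qed

lemma law_T_le_id:
  assumes "z \<in> perms n"
  shows "stoch_le (law_T n w z) (law_T n w [1..<Suc n])"
proof (rule law_T_antimono[OF id_perms assms])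
  show "yw_plus w z r \<le> yw_plus w [1..<Suc n] r" if "r < n" for r
    using sum_le_w_plus[OF take_perms_subset[OF assms], of r] less_imp_le[OF that]
    by (simp only: yw_plus_id yw_plus_eq_sum[OF assms] card_take_perms[OF assms])
qed

lemma law_T_ge_rev:
  assumes "z \<in> perms n"
  shows "stoch_le (law_T n w (rev [1..<Suc n])) (law_T n w z)"
proof (rule law_T_antimono[OF assms rev_perms])
  show "yw_plus w (rev [1..<Suc n]) r \<le> yw_plus w z r" if "r < n" for r
    using sum_ge_w_plus[OF take_perms_subset[OF assms], of r] less_imp_le[OF that]
    by (simp only: yw_plus_rev yw_plus_eq_sum[OF assms] card_take_perms[OF assms])
qed

end

theorem theorem3p1:
  fixes n :: nat and w :: "nat \<Rightarrow> real"
  assumes decreasing: "\<And>i j. 1 \<le> i \<Longrightarrow> i \<le> j \<Longrightarrow> j \<le> n \<Longrightarrow> w j \<le> w i"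
    and positive: "\<And>i. 1 \<le> i \<Longrightarrow> i \<le> n \<Longrightarrow> 0 < w i"
    and total: "(\<Sum>i=1..n. w i) = 1"
  shows "(\<forall>z\<in>perms n. \<forall>(M :: 'a measure) X U.
            fmmr_run (request_pmf n w) move_to_front (mtf_stationary n w) z M X U \<longrightarrow>
            distr M (count_space UNIV) (\<lambda>\<omega>. fmmr_time (perms n) move_to_front (\<lambda>k. U k \<omega>))
              = measure_pmf (map_pmf enat (law_T n w z)))
       \<and> (\<forall>z\<in>perms n. \<forall>z'\<in>perms n. bruhat_le z z' \<longrightarrow> stoch_le (law_T n w z') (law_T n w z))
       \<and> (\<forall>z\<in>perms n. stoch_le (law_T n w (rev [1..<Suc n])) (law_T n w z)
                     \<and> stoch_le (law_T n w z) (law_T n w [1..<Suc n]))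
       \<and> law_T n w (rev [1..<Suc n]) = Geom_conv {2..n} (w_plus w)
       \<and> law_T n w [1..<Suc n] = Geom_conv {..<n - 1} (\<lambda>r. 1 - w_plus w r)"
proof -
  interpret decreasing_weights n w
    using assms by unfold_locales
  show ?thesis
  proof (intro conjI ballI allI impI)
    fix z and M :: "'a measure" and X U
    assume z: "z \<in> perms n"
      and run: "fmmr_run (request_pmf n w) move_to_front (mtf_stationary n w) z M X U"
    interpret prob_space M
      using run by (simp add: fmmr_run_def)
    interpret mtf_process n w M z X U
      using z run by unfold_locales
        (simp_all only: mtf_stationary_nonzero_iff set_request move_to_front_perms)
    show "distr M (count_space UNIV) (\<lambda>\<omega>. fmmr_time (perms n) move_to_front (\<lambda>k. U k \<omega>))
        = measure_pmf (map_pmf enat (law_T n w z))"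
      by (rule distr_fmmr_time)
  next
    fix z z'
    assume "z \<in> perms n" "z' \<in> perms n" "bruhat_le z z'"
    then show "stoch_le (law_T n w z') (law_T n w z)"
      by (intro law_T_antimono bruhat_le_yw_plus) simp_all
  qed (rule law_T_ge_rev law_T_le_id law_T_rev law_T_id; assumption?)+
qed

end
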